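(* Let $0\leq s\leq n-2$ and let $G\in\mathfrak{C}_{n,s}$, i.e. $G$ is a connected graph on $n$ vertices with exactly $s$ cut vertices. Then $$\varepsilon\bigl(K_{n-s}^n(l_1',l_2',\ldots,l_{n-s}')\bigr)\leq \varepsilon(G),$$ where $l_1',\ldots,l_{n-s}'$ are positive integers with $l_1'+\cdots+l_{n-s}'=n$ and $|l_i'-l_j'|\leq 1$ for every $i,j\in\{1,2,\ldots,n-s\}$.
   Context: All graphs are finite, simple, connected and undirected. The eccentricity of a vertex $v$ of $G$ is $e_G(v)=\max\{d_G(v,u): u\in V(G)\}$, and the total eccentricity index is $\varepsilon(G)=\sum_{v\in V(G)}e_G(v)$. A vertex $w$ is a cut vertex of $G$ if $G-w$ is disconnected. $\mathfrak{C}_{n,s}$ is the set of all connected graphs on $n$ vertices with exactly $s$ cut vertices. For $2\leq m\leq n$ and integers $l_1,\ldots,l_m\geq 1$ with $l_1+\cdots+l_m=n$, $K_m^n(l_1,\ldots,l_m)$ is the graph on $n$ vertices obtained from the complete graph $K_m$ with vertices $v_1,\ldots,v_m$ by identifying, for each $i$, an end vertex of a path $P_{l_i}$ on $l_i$ vertices with $v_i$ (if $l_i=1$, the single vertex of $P_1$ is identified with $v_i$). *)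

theory Defs
  imports "Graph_Theory.Graph_Theory"
begin

text \<open>
  Finite simple undirected graphs are the symmetric, loop-free, finite digraphs of locale
  \<^locale>\<open>pair_graph\<close>. The library constant \<^const>\<open>Digraph_Component.connected\<close> is always written
  qualified, because topological connectedness has the same base name.
\<close>

text \<open>
  The value of \<open>gdist G u v\<close> is only meaningful if \<open>v\<close> is reachable from \<open>u\<close>; there it is the
  shortest-path distance of the library for unit arc weights, see \<open>\<mu>_eq_gdist\<close> below.
\<close>

definition gdist :: "('a, 'b) pre_digraph \<Rightarrow> 'a \<Rightarrow> 'a \<Rightarrow> nat" where
  "gdist G u v = (LEAST k. \<exists>p. pre_digraph.awalk G u p v \<and> length p = k)"

definition eccentricity :: "('a, 'b) pre_digraph \<Rightarrow> 'a \<Rightarrow> nat" where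
  "eccentricity G v = Max {gdist G v u |u. u \<in> verts G}"

definition total_eccentricity :: "('a, 'b) pre_digraph \<Rightarrow> nat" where
  "total_eccentricity G = (\<Sum>v\<in>verts G. eccentricity G v)"

text \<open>
  The library regards the null graph as not connected, so the vertex of a one-vertex graph counts
  as a cut vertex here. This does not matter for graphs with at least two vertices.
\<close>

definition cut_vertex :: "('a, 'b) pre_digraph \<Rightarrow> 'a \<Rightarrow> bool" where
  "cut_vertex G w \<longleftrightarrow> w \<in> verts G \<and> \<not> Digraph_Component.connected (pre_digraph.del_vert G w)"

definition connected_graphs_with_cut_vertices :: "nat \<Rightarrow> nat \<Rightarrow> 'a pair_pre_digraph set" where
  "connected_graphs_with_cut_vertices n s =
    {G. pair_graph G \<and> Digraph_Component.connected (with_proj G) \<and> card (pverts G) = n \<and>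
        card {w. cut_vertex (with_proj G) w} = s}"

text \<open>
  The graph $K_m^n(l_1,\dots,l_m)$ with $n = l_1 + \dots + l_m$: the vertices of the \<open>i\<close>-th path are
  \<open>(i, 1), \<dots>, (i, l i)\<close> in this order, and its end vertex \<open>(i, 1)\<close> is the clique vertex $v_i$.
\<close>

definition clique_with_paths :: "nat \<Rightarrow> (nat \<Rightarrow> nat) \<Rightarrow> (nat \<times> nat) pair_pre_digraph" where
  "clique_with_paths m l =
    \<lparr> pverts = (SIGMA i:{1..m}. {1..l i}),
      parcs = {((i, 1), (j, 1)) |i j. i \<in> {1..m} \<and> j \<in> {1..m} \<and> i \<noteq> j}
        \<union> {((i, k), (i, k + 1)) |i k. i \<in> {1..m} \<and> 1 \<le> k \<and> k + 1 \<le> l i}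
        \<union> {((i, k + 1), (i, k)) |i k. i \<in> {1..m} \<and> 1 \<le> k \<and> k + 1 \<le> l i} \<rparr>"

lemma (in wf_digraph) \<mu>_eq_gdist:
  assumes "u \<rightarrow>\<^sup>* v"
  shows "\<mu> (\<lambda>_. 1) u v = ereal (real (gdist G u v))"
proof -
  have cost: "awalk_cost (\<lambda>_. 1) p = real (length p)" for p :: "'b awalk"
    by (induction p) auto
  have "\<exists>k p. awalk u p v \<and> length p = k"
    using assms by (simp add: reachable_awalk)
  then have "\<exists>p. awalk u p v \<and> length p = gdist G u v"
    unfolding gdist_def by (rule LeastI_ex)
  then obtain p where p: "awalk u p v" "length p = gdist G u v"
    by blast
  have least: "gdist G u v \<le> length q" if "awalk u q v" for q
    unfolding gdist_def by (rule Least_le) (use that in blast)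
  show ?thesis
    unfolding \<mu>_def
  proof (rule antisym)
    show "(INF q\<in>{q. awalk u q v}. ereal (awalk_cost (\<lambda>_. 1) q)) \<le> ereal (real (gdist G u v))"
      by (rule INF_lower2[of p]) (use p in \<open>auto simp: cost\<close>)
    show "ereal (real (gdist G u v)) \<le> (INF q\<in>{q. awalk u q v}. ereal (awalk_cost (\<lambda>_. 1) q))"
      by (rule INF_greatest) (use least in \<open>auto simp: cost\<close>)
  qed
qed

lemma card_pverts_clique_with_paths:
  "card (pverts (clique_with_paths m l)) = (\<Sum>i=1..m. l i)"
  by (simp add: clique_with_paths_def)

lemma pair_graph_clique_with_paths:
  assumes "\<And>i. i \<in> {1..m} \<Longrightarrow> l i \<ge> 1"
  shows "pair_graph (clique_with_paths m l)"
proof -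
  let ?K = "clique_with_paths m l"
  have sub: "parcs ?K \<subseteq> pverts ?K \<times> pverts ?K"
    using assms by (fastforce simp: clique_with_paths_def)
  have fin: "finite (pverts ?K)"
    by (simp add: clique_with_paths_def)
  show ?thesis
  proof
    show "fst e \<in> pverts ?K" "snd e \<in> pverts ?K" if "e \<in> parcs ?K" for e
      using sub that by auto
    show "finite (pverts ?K)" by (rule fin)
    show "finite (parcs ?K)"
      using sub fin by (meson finite_SigmaI finite_subset)
    show "fst e \<noteq> snd e" if "e \<in> parcs ?K" for e
      using that by (auto simp: clique_with_paths_def)
    show "symmetric (with_proj ?K)"
      unfolding symmetric_def sym_def by (auto simp: clique_with_paths_def)
  qed
qed

end

theory Submission
  imports Defs
begin

text \<open>
  Let \<open>G\<close> be connected with \<open>n\<close> vertices, \<open>m\<close> of them non-cut vertices. Call a union of components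
  of \<open>G - v\<close> a branch at \<open>v\<close>. A shortest path out of a branch at \<open>v\<close> passes through \<open>v\<close>, every branch
  contains a non-cut vertex, and a cut vertex has a branch that avoids any prescribed vertex.

  The proof rests on one injection (\<open>card_level_le_noncut\<close>): if a function \<open>f\<close> on the vertices
  is such that every cut vertex \<open>v\<close> has a branch on which \<open>f\<close> exceeds \<open>f v\<close>, then each level set of
  \<open>f\<close> has at most \<open>m\<close> elements. It applies to two functions.

  For the eccentricity, take a branch at \<open>v\<close> that avoids a vertex farthest from \<open>v\<close>: each value is
  taken at most \<open>m\<close> times. For the distance from a vertex \<open>c\<close>, take a branch that avoids \<open>c\<close>: the
  distance layers around \<open>c\<close> have at most \<open>m\<close> elements each, so \<open>n \<le> 1 + m * e(c)\<close>. In the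
  extreme case \<open>n = 1 + m * q\<close> at most one vertex has eccentricity \<open>q\<close>
  (\<open>unique_center_if_extremal\<close>), because all layers around such a vertex are full and the last one
  consists of all non-cut vertices.

  So \<open>G\<close> has at most as many vertices of eccentricity \<open>\<le> e\<close> as this allows: \<open>m\<close> for each value from
  the lower bound for the radius on, respectively one for the value \<open>q\<close> and \<open>m\<close> for each larger value if
  \<open>n = 1 + m * q\<close>. The clique with balanced paths has at least that many for every \<open>e\<close>, until all
  its \<open>n\<close> vertices are counted: eccentricities there grow by one along each path, starting
  from the largest order of another path. The case \<open>n = 1 + m * q\<close> is the one where exactly one
  path is longer than all others. Comparing these counts for every \<open>e\<close> compares the sums
  (\<open>sum_mono_if_card_atMost\<close>).
\<close>

section \<open>Comparing sums by counting small summands\<close>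

text \<open>Double counting: the sum of \<open>f\<close> over \<open>A\<close> is the number of pairs \<open>(a, e)\<close> with \<open>e < f a\<close>.\<close>

lemma sum_eq_sum_card_less:
  fixes f :: "'a \<Rightarrow> nat"
  assumes "finite A" "\<And>a. a \<in> A \<Longrightarrow> f a \<le> N"
  shows "(\<Sum>a\<in>A. f a) = (\<Sum>e<N. card {a \<in> A. e < f a})"
proof -
  have "(\<Sum>a\<in>A. f a) = (\<Sum>a\<in>A. card {e \<in> {..<N}. e < f a})"
  proof (rule sum.cong[OF refl])
    fix a assume "a \<in> A"
    then have "{e \<in> {..<N}. e < f a} = {..<f a}" using assms(2)[of a] by auto
    then show "f a = card {e \<in> {..<N}. e < f a}" by simp
  qed
  also have "\<dots> = (\<Sum>e<N. card {a \<in> A. e < f a})"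
    by (rule sum_multicount_gen) (use assms(1) in auto)
  finally show ?thesis .
qed

lemma sum_mono_if_card_atMost:
  fixes f :: "'a \<Rightarrow> nat" and g :: "'b \<Rightarrow> nat"
  assumes fin: "finite A" "finite B" and card: "card A = card B"
    and le: "\<And>e. card {b \<in> B. g b \<le> e} \<le> card {a \<in> A. f a \<le> e}"
  shows "(\<Sum>a\<in>A. f a) \<le> (\<Sum>b\<in>B. g b)"
proof -
  have compl: "card {x \<in> X. e < h x} = card X - card {x \<in> X. h x \<le> e}" if "finite X"
    for X :: "'c set" and h :: "'c \<Rightarrow> nat" and e
  proof -
    have "{x \<in> X. e < h x} = X - {x \<in> X. h x \<le> e}" by auto
    then show ?thesis using that by (simp add: card_Diff_subset)
  qed
  let ?N = "(\<Sum>a\<in>A. f a) + (\<Sum>b\<in>B. g b)"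
  have "f a \<le> ?N" if "a \<in> A" for a using fin(1) that by (simp add: member_le_sum trans_le_add1)
  then have "(\<Sum>a\<in>A. f a) = (\<Sum>e<?N. card {a \<in> A. e < f a})"
    by (rule sum_eq_sum_card_less[OF fin(1)])
  also have "\<dots> \<le> (\<Sum>e<?N. card {b \<in> B. e < g b})"
    unfolding compl[OF fin(1)] compl[OF fin(2)] using card le by (intro sum_mono) (simp add: diff_le_mono2)
  also have "\<dots> = (\<Sum>b\<in>B. g b)"
  proof (rule sum_eq_sum_card_less[OF fin(2), symmetric])
    show "g b \<le> ?N" if "b \<in> B" for b using fin(2) that by (simp add: member_le_sum trans_le_add2)
  qed
  finally show ?thesis .
qed

section \<open>Distances\<close>

context wf_digraph
begin

lemma gdist_le_length: "awalk u p v \<Longrightarrow> gdist G u v \<le> length p"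
  unfolding gdist_def by (rule Least_le) blast

lemma shortest_awalk_exists:
  assumes "u \<rightarrow>\<^sup>* v"
  obtains p where "awalk u p v" "length p = gdist G u v"
proof -
  have "\<exists>k p. awalk u p v \<and> length p = k"
    using assms by (simp add: reachable_awalk)
  then have "\<exists>p. awalk u p v \<and> length p = gdist G u v"
    unfolding gdist_def by (rule LeastI_ex)
  then show thesis
    using that by blast
qed

lemma gdist_self: "v \<in> verts G \<Longrightarrow> gdist G v v = 0"
  using gdist_le_length[of v "[]" v] by (simp add: awalk_Nil_iff)

lemma gdist_eq_0D:
  assumes "u \<rightarrow>\<^sup>* v" "gdist G u v = 0"
  shows "u = v"
  using shortest_awalk_exists[OF assms(1)] assms(2) by (metis awalk_Nil_iff length_0_conv)

lemma awalk_stays_in_closed_set: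
  assumes "awalk x p y" "x \<in> S" "\<And>a b. a \<in> S \<Longrightarrow> a \<rightarrow> b \<Longrightarrow> b \<in> S"
  shows "y \<in> S"
  using assms
proof (induction p arbitrary: x)
  case (Cons e p)
  then show ?case
    by (metis awalk_Cons_iff in_arcs_imp_in_arcs_ends)
qed (simp add: awalk_Nil_iff)

end

lemma (in sym_digraph) awalk_reverse_exists:
  assumes "awalk u p v"
  shows "\<exists>q. awalk v q u \<and> length q = length p"
  using assms
proof (induction p arbitrary: u)
  case (Cons e p)
  then have e: "e \<in> arcs G" "u = tail G e" and p: "awalk (head G e) p v"
    by (simp_all add: awalk_Cons_iff)
  from Cons.IH[OF p] obtain q where q: "awalk v q (head G e)" "length q = length p"
    by blast
  obtain e' where "e' \<in> arcs G" "tail G e' = head G e" "head G e' = tail G e"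
    using sym_arcs e(1) unfolding symmetric_conv by metis
  then have "awalk (head G e) [e'] u"
    using e(2) arc_implies_awalk by metis
  with q have "awalk v (q @ [e']) u \<and> length (q @ [e']) = length (e # p)"
    by (auto intro: awalk_appendI)
  then show ?case by blast
qed (auto simp: awalk_Nil_iff intro: exI[of _ "[]"])

lemma (in fin_digraph)
  assumes "v \<in> verts G"
  shows gdist_le_eccentricity: "u \<in> verts G \<Longrightarrow> gdist G v u \<le> eccentricity G v"
    and eccentricity_attained: "\<exists>u\<in>verts G. gdist G v u = eccentricity G v"
    and eccentricity_le: "(\<And>u. u \<in> verts G \<Longrightarrow> gdist G v u \<le> k) \<Longrightarrow> eccentricity G v \<le> k"
proof -
  let ?S = "{gdist G v u |u. u \<in> verts G}"
  have S: "finite ?S" "?S \<noteq> {}"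
    using assms by auto
  show "gdist G v u \<le> eccentricity G v" if "u \<in> verts G"
    unfolding eccentricity_def by (rule Max_ge[OF S(1)]) (use that in blast)
  have "eccentricity G v \<in> ?S"
    unfolding eccentricity_def by (rule Max_in[OF S])
  then show "\<exists>u\<in>verts G. gdist G v u = eccentricity G v"
    by auto
  then show "eccentricity G v \<le> k" if "\<And>u. u \<in> verts G \<Longrightarrow> gdist G v u \<le> k"
    using that by metis
qed

section \<open>Branches at a vertex\<close>

text \<open>
  A nonempty union of components of \<open>G - v\<close>, described by the fact that all arcs leaving it end in
  \<open>v\<close>. In this form, intersections and differences of branches are handled by showing that
  they are closed under adjacency.
\<close>

definition (in pre_digraph) branch :: "'a \<Rightarrow> 'a set \<Rightarrow> bool" where
  "branch v D \<longleftrightarrow> D \<subseteq> verts G \<and> D \<noteq> {} \<and> v \<notin> D \<and> (\<forall>x\<in>D. \<forall>y. x \<rightarrow> y \<longrightarrow> y \<in> D \<or> y = v)"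

lemma (in wf_digraph) awalk_leaving_branch:
  assumes "branch v D" "awalk w p u" "w \<in> D" "u \<notin> D"
  shows "\<exists>p1 p2. awalk w p1 v \<and> awalk v p2 u \<and> length p = length p1 + length p2"
  using assms(2,3)
proof (induction p arbitrary: w)
  case Nil
  then show ?case using assms(4) by (simp add: awalk_Nil_iff)
next
  case (Cons e p)
  then have e: "e \<in> arcs G" "w = tail G e" and p: "awalk (head G e) p u"
    by (simp_all add: awalk_Cons_iff)
  have "w \<rightarrow> head G e"
    using e in_arcs_imp_in_arcs_ends by blast
  then consider "head G e \<in> D" | "head G e = v"
    using assms(1) Cons.prems(2) unfolding branch_def by blast
  then show ?case
  proof cases
    case 1
    from Cons.IH[OF p 1] obtain p1 p2
      where "awalk (head G e) p1 v" "awalk v p2 u" "length p = length p1 + length p2"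
      by blast
    then have "awalk w (e # p1) v \<and> awalk v p2 u \<and> length (e # p) = length (e # p1) + length p2"
      using e by (simp add: awalk_Cons_iff)
    then show ?thesis by blast
  next
    case 2
    then have "awalk w [e] v \<and> awalk v p u \<and> length (e # p) = length [e] + length p"
      using e p arc_implies_awalk by auto
    then show ?thesis by blast
  qed
qed

locale nontrivial_connected_graph = pseudo_graph +
  assumes connected: "Digraph_Component.connected G"
    and two_le_card_verts: "2 \<le> card (verts G)"
begin

lemma reachable_verts: "u \<in> verts G \<Longrightarrow> v \<in> verts G \<Longrightarrow> u \<rightarrow>\<^sup>* v"
  using symmetric_connected_imp_strongly_connected[OF sym_arcs connected] by auto

lemma closed_set_is_everything:
  assumes "S \<subseteq> verts G" "S \<noteq> {}" "\<And>a b. a \<in> S \<Longrightarrow> a \<rightarrow> b \<Longrightarrow> b \<in> S"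
  shows "S = verts G"
proof -
  have "y \<in> S" if "y \<in> verts G" for y
  proof -
    obtain x where "x \<in> S" using assms(2) by blast
    then have "x \<rightarrow>\<^sup>* y" using reachable_verts that assms(1) by blast
    then obtain p where "awalk x p y" unfolding reachable_awalk by blast
    then show ?thesis
      using awalk_stays_in_closed_set \<open>x \<in> S\<close> assms(3) by blast
  qed
  then show ?thesis using assms(1) by blast
qed

lemma gdist_commute:
  assumes "u \<in> verts G" "v \<in> verts G"
  shows "gdist G u v = gdist G v u"
proof -
  have "gdist G v u \<le> gdist G u v" if "u \<in> verts G" "v \<in> verts G" for u v
    using shortest_awalk_exists[OF reachable_verts[OF that]] awalk_reverse_exists gdist_le_length
    by metis
  then show ?thesis using assms by (meson order.antisym)
qed

lemma gdist_pos: "u \<in> verts G \<Longrightarrow> v \<in> verts G \<Longrightarrow> u \<noteq> v \<Longrightarrow> 0 < gdist G u v"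
  using gdist_eq_0D reachable_verts by blast

text \<open>Every walk out of a branch at \<open>v\<close> passes through \<open>v\<close>; split a shortest one there.\<close>

lemma gdist_from_branch:
  assumes "branch v D" "w \<in> D" "u \<in> verts G" "u \<notin> D"
  shows "gdist G w v + gdist G v u \<le> gdist G w u"
proof -
  have "w \<in> verts G" using assms(1,2) unfolding branch_def by blast
  then obtain p where p: "awalk w p u" "length p = gdist G w u"
    using shortest_awalk_exists reachable_verts assms(3) by metis
  from awalk_leaving_branch[OF assms(1) p(1) assms(2,4)] obtain p1 p2
    where "awalk w p1 v" "awalk v p2 u" "length p = length p1 + length p2"
    by blast
  then show ?thesis
    using p(2) gdist_le_length by (metis add_le_mono)
qed

lemma gdist_less_in_branch:
  assumes "v \<in> verts G" "branch v D" "w \<in> D" "u \<in> verts G" "u \<notin> D"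
  shows "gdist G v u < gdist G w u" "gdist G u v < gdist G u w"
proof -
  have w: "w \<in> verts G" "w \<noteq> v" using assms(2,3) unfolding branch_def by blast+
  show less: "gdist G v u < gdist G w u"
    using gdist_from_branch[OF assms(2-5)] gdist_pos[OF w(1) assms(1) w(2)] by linarith
  then show "gdist G u v < gdist G u w"
    using assms(1,4) w(1) by (simp add: gdist_commute)
qed

text \<open>
  If \<open>b\<close> cannot be reached from \<open>a\<close> in \<open>G - v\<close>, then the sets of vertices reachable there from
  \<open>a\<close> and from \<open>b\<close> are disjoint, so one of them omits \<open>u\<close>.
\<close>

lemma cut_vertex_branch_avoiding:
  assumes "cut_vertex G v"
  obtains D where "branch v D" "u \<notin> D"
proof -
  let ?H = "del_vert v"
  have v: "v \<in> verts G" and nc: "\<not> Digraph_Component.connected ?H"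
    using assms unfolding cut_vertex_def by auto
  interpret H: wf_digraph ?H by (rule wf_digraph_del_vert)
  have H_dom: "a \<rightarrow>\<^bsub>?H\<^esub> b \<longleftrightarrow> a \<rightarrow> b \<and> a \<noteq> v \<and> b \<noteq> v" for a b
    by (auto simp: arcs_ends_conv del_vert_simps)
  have H_sym: "symmetric ?H"
    using sym_arcs unfolding symmetric_def sym_def H_dom by blast
  have "verts G \<noteq> {v}" using two_le_card_verts by auto
  then have ne: "verts ?H \<noteq> {}" using v by (auto simp: del_vert_simps)
  have "\<exists>a\<in>verts ?H. \<exists>b\<in>verts ?H. \<not> a \<rightarrow>\<^sup>*\<^bsub>?H\<^esub> b"
  proof (rule ccontr)
    assume "\<not> ?thesis"
    then have "Digraph_Component.connected ?H"
      by (intro H.connectedI ne H.reachable_mk_symmetricI) auto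
    with nc show False by blast
  qed
  then obtain a b where ab: "a \<in> verts ?H" "b \<in> verts ?H" "\<not> a \<rightarrow>\<^sup>*\<^bsub>?H\<^esub> b"
    by blast
  have branch: "branch v {x. c \<rightarrow>\<^sup>*\<^bsub>?H\<^esub> x}" if c: "c \<in> verts ?H" for c
    unfolding branch_def
  proof (intro conjI ballI allI impI)
    show "{x. c \<rightarrow>\<^sup>*\<^bsub>?H\<^esub> x} \<subseteq> verts G" "v \<notin> {x. c \<rightarrow>\<^sup>*\<^bsub>?H\<^esub> x}"
      by (auto dest: H.reachable_in_verts(2) simp: verts_del_vert)
    show "{x. c \<rightarrow>\<^sup>*\<^bsub>?H\<^esub> x} \<noteq> {}" using H.reachable_refl[OF c] by blast
    fix x y assume x: "x \<in> {x. c \<rightarrow>\<^sup>*\<^bsub>?H\<^esub> x}" and xy: "x \<rightarrow> y"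
    show "y \<in> {x. c \<rightarrow>\<^sup>*\<^bsub>?H\<^esub> x} \<or> y = v"
    proof (cases "y = v")
      case False
      have "x \<noteq> v" using x by (auto dest: H.reachable_in_verts(2) simp: verts_del_vert)
      then have "x \<rightarrow>\<^bsub>?H\<^esub> y" using False xy H_dom by blast
      then show ?thesis using x H.reachable_adj_trans by blast
    qed simp
  qed
  have "\<not> (a \<rightarrow>\<^sup>*\<^bsub>?H\<^esub> u \<and> b \<rightarrow>\<^sup>*\<^bsub>?H\<^esub> u)"
    using ab(3) symmetric_reachable[OF H_sym] H.reachable_trans by metis
  then show thesis
    using that branch ab(1,2) by blast
qed

text \<open>
  The intersection of two branches that do not contain each other's roots would be closed under
  adjacency, unless both branches have the same root.
\<close>

lemma branch_roots_eq:
  assumes "v \<in> verts G" "branch v D" "branch v' D'" "v \<notin> D'" "v' \<notin> D" "x \<in> D" "x \<in> D'"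
  shows "v = v'"
proof (rule ccontr)
  assume "v \<noteq> v'"
  have "D \<inter> D' = verts G"
  proof (rule closed_set_is_everything)
    show "D \<inter> D' \<subseteq> verts G" "D \<inter> D' \<noteq> {}"
      using assms unfolding branch_def by blast+
    show "b \<in> D \<inter> D'" if a: "a \<in> D \<inter> D'" and ab: "a \<rightarrow> b" for a b
    proof -
      have "b \<in> D \<or> b = v" "b \<in> D' \<or> b = v'"
        using assms(2,3) a ab unfolding branch_def by blast+
      then show ?thesis using assms(4,5) \<open>v \<noteq> v'\<close> by blast
    qed
  qed
  then show False using assms(1,4) by blast
qed

definition noncut :: "'a set" where
  "noncut = {v \<in> verts G. \<not> cut_vertex G v}"

lemma finite_noncut: "finite noncut"
  unfolding noncut_def by simp

text \<open>
  A vertex \<open>x\<close> of \<open>D\<close> farthest from \<open>v\<close> is not a cut vertex: a branch at \<open>x\<close> that avoids \<open>v\<close> would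
  lie inside \<open>D\<close>, and its vertices are even farther from \<open>v\<close>.
\<close>

lemma branch_contains_noncut:
  assumes v: "v \<in> verts G" and D: "branch v D"
  obtains x where "x \<in> D" "x \<in> noncut"
proof -
  have D_sub: "D \<subseteq> verts G" "D \<noteq> {}" and "v \<notin> D" using D unfolding branch_def by blast+
  then have fin: "finite D" using finite_verts finite_subset by blast
  have "Max (gdist G v ` D) \<in> gdist G v ` D"
    using fin D_sub(2) by (intro Max_in) auto
  then obtain x where "x \<in> D" and max: "gdist G v x = Max (gdist G v ` D)"
    by auto
  then have x: "x \<in> D" "\<And>y. y \<in> D \<Longrightarrow> gdist G v y \<le> gdist G v x"
    using fin by simp_all
  have xV: "x \<in> verts G" using x(1) D_sub(1) by blast
  have "\<not> cut_vertex G x"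
  proof
    assume "cut_vertex G x"
    then obtain E where E: "branch x E" "v \<notin> E"
      by (rule cut_vertex_branch_avoiding)
    have "E - D = {}"
    proof (rule ccontr)
      assume "E - D \<noteq> {}"
      have "b \<in> E - D" if a: "a \<in> E - D" and ab: "a \<rightarrow> b" for a b
      proof -
        have ba: "b \<rightarrow> a" using arcs_ends_symmetric[OF sym_arcs ab] .
        have "a \<noteq> v" using a E(2) by blast
        then have "b \<notin> D" using D a ba unfolding branch_def by blast
        then show ?thesis using E(1) a ab x(1) unfolding branch_def by blast
      qed
      moreover have "E - D \<subseteq> verts G" using E(1) unfolding branch_def by blast
      ultimately have "E - D = verts G"
        using \<open>E - D \<noteq> {}\<close> by (intro closed_set_is_everything) blast+
      then show False using v E(2) by blast
    qed
    moreover obtain w where w: "w \<in> E" using E(1) unfolding branch_def by blast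
    ultimately have "gdist G v w \<le> gdist G v x" using x(2) by blast
    moreover have "gdist G v x < gdist G v w"
      using gdist_less_in_branch(2)[OF xV E(1) w v E(2)] .
    ultimately show False by linarith
  qed
  then show thesis using that x(1) xV unfolding noncut_def by blast
qed

section \<open>Level sets have at most as many elements as there are non-cut vertices\<close>

text \<open>
  Map a cut vertex \<open>v\<close> of the level to a non-cut vertex in a branch on which \<open>f\<close> is larger
  than at \<open>v\<close>, and any other vertex to itself. Such a branch contains no vertex of the level, so
  two cut vertices cannot share an image, nor can a cut vertex be sent to a non-cut vertex of the
  level.
\<close>

lemma card_level_le_noncut:
  fixes f :: "'a \<Rightarrow> nat"
  assumes inc: "\<And>v. cut_vertex G v \<Longrightarrow> \<exists>D. branch v D \<and> (\<forall>w\<in>D. f v < f w)"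
  shows "card {v \<in> verts G. f v = k} \<le> card noncut"
proof -
  obtain D where D: "\<And>v. cut_vertex G v \<Longrightarrow> branch v (D v)"
      "\<And>v w. cut_vertex G v \<Longrightarrow> w \<in> D v \<Longrightarrow> f v < f w"
    using inc by metis
  have cutV: "cut_vertex G v \<Longrightarrow> v \<in> verts G" for v
    unfolding cut_vertex_def by blast
  have "\<exists>x. x \<in> D v \<and> x \<in> noncut" if "cut_vertex G v" for v
    using branch_contains_noncut[OF cutV[OF that] D(1)[OF that]] by blast
  then obtain t where t: "\<And>v. cut_vertex G v \<Longrightarrow> t v \<in> D v \<and> t v \<in> noncut"
    by metis
  let ?h = "\<lambda>v. if cut_vertex G v then t v else v"
  let ?L = "{v \<in> verts G. f v = k}"
  have "inj_on ?h ?L"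
  proof (rule inj_onI)
    fix v v' assume v: "v \<in> ?L" "v' \<in> ?L" and eq: "?h v = ?h v'"
    show "v = v'"
    proof (cases "cut_vertex G v \<and> cut_vertex G v'")
      case True
      then have "v \<notin> D v'" "v' \<notin> D v"
        using D(2)[of v v'] D(2)[of v' v] v by auto
      then show ?thesis
        using branch_roots_eq[of v "D v" v' "D v'" "t v"] True D(1)[of v] D(1)[of v']
          t[of v] t[of v'] eq v by simp
    next
      case False
      have less: "k < f (t z)" if "cut_vertex G z" "z \<in> ?L" for z
        using D(2)[OF that(1)] t[OF that(1)] that(2) by auto
      consider "\<not> cut_vertex G v" "\<not> cut_vertex G v'"
        | "cut_vertex G v" "\<not> cut_vertex G v'" | "\<not> cut_vertex G v" "cut_vertex G v'"
        using False by blast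
      then show ?thesis
      proof cases
        case 1 then show ?thesis using eq by simp
      next
        case 2 then show ?thesis using eq v less[of v] by simp
      next
        case 3 then show ?thesis using eq v less[of v'] by auto
      qed
    qed
  qed
  moreover have "?h ` ?L \<subseteq> noncut"
    using t unfolding noncut_def by auto
  ultimately show ?thesis
    using card_inj_on_le finite_noncut by blast
qed

text \<open>
  Let \<open>u\<close> be farthest from the cut vertex \<open>v\<close>. From a branch that avoids \<open>u\<close>, every path to \<open>u\<close>
  passes through \<open>v\<close>, so the eccentricities on it are larger.
\<close>

lemma card_eccentricity_level: "card {v \<in> verts G. eccentricity G v = k} \<le> card noncut"
proof (rule card_level_le_noncut)
  fix v assume cut: "cut_vertex G v"
  then have v: "v \<in> verts G" unfolding cut_vertex_def by blast
  then obtain u where u: "u \<in> verts G" "gdist G v u = eccentricity G v"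
    using eccentricity_attained by blast
  obtain D where D: "branch v D" "u \<notin> D"
    using cut_vertex_branch_avoiding[OF cut] .
  have "eccentricity G v < eccentricity G w" if w: "w \<in> D" for w
  proof -
    have "w \<in> verts G" using D(1) w unfolding branch_def by blast
    then show ?thesis
      using gdist_less_in_branch(1)[OF v D(1) w u(1) D(2)] gdist_le_eccentricity u
      by (metis order_less_le_trans)
  qed
  then show "\<exists>D. branch v D \<and> (\<forall>w\<in>D. eccentricity G v < eccentricity G w)"
    using D(1) by blast
qed

lemma card_distance_level:
  assumes "c \<in> verts G"
  shows "card {v \<in> verts G. gdist G c v = k} \<le> card noncut"
proof (rule card_level_le_noncut)
  fix v assume cut: "cut_vertex G v"
  then have v: "v \<in> verts G" unfolding cut_vertex_def by blast
  obtain D where "branch v D" "c \<notin> D"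
    using cut_vertex_branch_avoiding[OF cut] .
  then show "\<exists>D. branch v D \<and> (\<forall>w\<in>D. gdist G c v < gdist G c w)"
    using gdist_less_in_branch(2)[OF v _ _ assms] by blast
qed

lemma card_eccentricity_atMost:
  assumes "\<And>v. v \<in> verts G \<Longrightarrow> r \<le> eccentricity G v"
  shows "card {v \<in> verts G. eccentricity G v \<le> e} \<le> card noncut * (e + 1 - r)"
proof -
  have "{v \<in> verts G. eccentricity G v \<le> e} = (\<Union>k\<in>{r..e}. {v \<in> verts G. eccentricity G v = k})"
    using assms by auto
  also have "card \<dots> \<le> (\<Sum>k\<in>{r..e}. card {v \<in> verts G. eccentricity G v = k})"
    by (rule card_UN_le) simp
  also have "\<dots> \<le> (\<Sum>k\<in>{r..e}. card noncut)"
    by (rule sum_mono) (rule card_eccentricity_level)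
  finally show ?thesis by (simp add: mult.commute)
qed

lemma card_verts_by_distance:
  assumes "c \<in> verts G"
  shows "card (verts G) = 1 + (\<Sum>k=1..eccentricity G c. card {v \<in> verts G. gdist G c v = k})"
proof -
  let ?L = "\<lambda>k. {v \<in> verts G. gdist G c v = k}"
  have "verts G = (\<Union>k\<in>{0..eccentricity G c}. ?L k)"
    using gdist_le_eccentricity[OF assms] by auto
  then have "card (verts G) = card (\<Union>k\<in>{0..eccentricity G c}. ?L k)"
    by (rule arg_cong)
  also have "\<dots> = (\<Sum>k\<in>{0..eccentricity G c}. card (?L k))"
    by (rule card_UN_disjoint) auto
  also have "?L 0 = {c}"
    using gdist_self[OF assms] gdist_pos assms by fastforce
  then have "(\<Sum>k\<in>{0..eccentricity G c}. card (?L k)) = 1 + (\<Sum>k=1..eccentricity G c. card (?L k))"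
    by (simp add: sum.atLeast_Suc_atMost)
  finally show ?thesis .
qed

lemma card_verts_le_eccentricity:
  assumes "c \<in> verts G"
  shows "card (verts G) \<le> 1 + card noncut * eccentricity G c"
proof -
  have "(\<Sum>k=1..eccentricity G c. card {v \<in> verts G. gdist G c v = k}) \<le> (\<Sum>k=1..eccentricity G c. card noncut)"
    by (rule sum_mono) (rule card_distance_level[OF assms])
  then show ?thesis
    unfolding card_verts_by_distance[OF assms] by (simp add: mult.commute)
qed

text \<open>
  All layers around \<open>c\<close> must have exactly \<open>card noncut\<close> elements. The last layer contains no cut
  vertex, since its branch avoiding \<open>c\<close> would be farther away; so it is the set of all
  non-cut vertices.
\<close>

lemma noncut_farthest_if_extremal:
  assumes c: "c \<in> verts G" and n: "card (verts G) = 1 + card noncut * eccentricity G c"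
    and x: "x \<in> noncut"
  shows "gdist G c x = eccentricity G c"
proof -
  let ?q = "eccentricity G c" and ?L = "\<lambda>k. {v \<in> verts G. gdist G c v = k}"
  have q: "0 < ?q" using n two_le_card_verts by (cases "?q = 0") auto
  have "(\<Sum>k=1..?q. card (?L k)) = card noncut * ?q"
    using n card_verts_by_distance[OF c] by simp
  moreover have "(\<Sum>k=1..?q. card (?L k)) = card (?L ?q) + (\<Sum>k\<in>{1..?q}-{?q}. card (?L k))"
    by (rule sum.remove) (use q in auto)
  moreover have "(\<Sum>k\<in>{1..?q}-{?q}. card (?L k)) \<le> (\<Sum>k\<in>{1..?q}-{?q}. card noncut)"
    by (rule sum_mono) (rule card_distance_level[OF c])
  moreover have "card ({1..?q} - {?q}) = ?q - 1" using q by simp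
  then have "(\<Sum>k\<in>{1..?q}-{?q}. card noncut) = card noncut * ?q - card noncut"
    by (simp add: diff_mult_distrib mult.commute[of "card noncut"])
  moreover have "card noncut \<le> card noncut * ?q" using q by simp
  ultimately have card_L: "card noncut \<le> card (?L ?q)" by linarith
  have "?L ?q \<subseteq> noncut"
  proof
    fix y assume y: "y \<in> ?L ?q"
    have "\<not> cut_vertex G y"
    proof
      assume "cut_vertex G y"
      then obtain D where D: "branch y D" "c \<notin> D"
        by (rule cut_vertex_branch_avoiding)
      then obtain w where w: "w \<in> D" "w \<in> verts G" unfolding branch_def by blast
      have "gdist G c y < gdist G c w"
        using gdist_less_in_branch(2)[OF _ D(1) w(1) c D(2)] y by blast
      then show False
        using y gdist_le_eccentricity[OF c w(2)] by simp
    qed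
    then show "y \<in> noncut" using y unfolding noncut_def by blast
  qed
  then have "?L ?q = noncut"
    using card_L finite_noncut by (intro card_seteq)
  then show ?thesis using x by blast
qed

text \<open>
  Every non-cut vertex has distance \<open>q\<close> from both \<open>c\<close> and \<open>c'\<close>, so \<open>c'\<close> is a cut vertex. A non-cut
  vertex in a branch at \<open>c'\<close> that avoids \<open>c\<close> would be farther from \<open>c\<close> than from \<open>c'\<close>.
\<close>

lemma unique_center_if_extremal:
  assumes c: "c \<in> verts G" "eccentricity G c = q" and c': "c' \<in> verts G" "eccentricity G c' = q"
    and n: "card (verts G) = 1 + card noncut * q"
  shows "c = c'"
proof (rule ccontr)
  assume "c \<noteq> c'"
  have q: "q \<noteq> 0" using n two_le_card_verts by (cases "q = 0") auto
  have far: "gdist G c x = q" "gdist G c' x = q" if "x \<in> noncut" for x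
    using noncut_farthest_if_extremal that c c' n by auto
  have "c' \<notin> noncut"
    using far(2) gdist_self[OF c'(1)] q by auto
  then have "cut_vertex G c'" using c'(1) unfolding noncut_def by blast
  then obtain D where D: "branch c' D" "c \<notin> D"
    by (rule cut_vertex_branch_avoiding)
  obtain x where x: "x \<in> D" "x \<in> noncut"
    using branch_contains_noncut[OF c'(1) D(1)] .
  have xV: "x \<in> verts G" using x(2) unfolding noncut_def by blast
  have "gdist G x c' + gdist G c' c \<le> gdist G x c"
    using gdist_from_branch[OF D(1) x(1) c(1) D(2)] .
  moreover have "gdist G x c' = q" "gdist G x c = q"
    using far[OF x(2)] xV c(1) c'(1) by (simp_all add: gdist_commute)
  moreover have "0 < gdist G c' c" using gdist_pos c(1) c'(1) \<open>c \<noteq> c'\<close> by blast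
  ultimately show False by linarith
qed

section \<open>Lower bounds for the total eccentricity\<close>

text \<open>
  The pairs \<open>(i, k)\<close> stand for the vertices of the clique with paths of orders \<open>l i\<close>, and the summand
  is the eccentricity of \<open>(i, k)\<close> there if the largest order \<open>r\<close> occurs at least twice, which
  is where the bound \<open>m * (r - 1) + 2\<close> for the number of vertices comes from. That bound
  forces all eccentricities of \<open>G\<close> to be at least \<open>r\<close>.
\<close>

lemma total_eccentricity_ge_several_longest:
  fixes l :: "nat \<Rightarrow> nat"
  assumes m: "card noncut = m" and n: "card (verts G) = (\<Sum>i=1..m. l i)"
    and l: "\<And>i. i \<in> {1..m} \<Longrightarrow> r - 1 \<le> l i \<and> l i \<le> r"
    and r: "m * (r - 1) + 2 \<le> card (verts G)"
  shows "(\<Sum>(i, k)\<in>(SIGMA i:{1..m}. {1..l i}). r + k - 1) \<le> total_eccentricity G"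
  unfolding total_eccentricity_def
proof (rule sum_mono_if_card_atMost)
  let ?B = "SIGMA i:{1..m}. {1..l i}"
  let ?A = "\<lambda>e. {v \<in> verts G. eccentricity G v \<le> e}"
  let ?K = "\<lambda>e. {x \<in> ?B. (case x of (i, k) \<Rightarrow> r + k - 1) \<le> e}"
  show "finite ?B" "finite (verts G)" by auto
  show "card ?B = card (verts G)" using n by simp
  fix e
  have ecc: "r \<le> eccentricity G v" if "v \<in> verts G" for v
  proof (rule ccontr)
    assume "\<not> r \<le> eccentricity G v"
    then have "m * eccentricity G v \<le> m * (r - 1)" by (intro mult_le_mono2) simp
    then show False using card_verts_le_eccentricity[OF that, unfolded m] r by linarith
  qed
  show "card (?A e) \<le> card (?K e)"
  proof (cases "e + 1 - r \<le> r - 1")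
    case True
    \<comment> \<open>No path has ended yet: each contributes its first \<open>e + 1 - r\<close> vertices, like \<open>m\<close> vertices
      for each eccentricity from \<open>r\<close> to \<open>e\<close>.\<close>
    have "card (?A e) \<le> m * (e + 1 - r)"
      using card_eccentricity_atMost[OF ecc] m by simp
    also have "\<dots> = card ({1..m} \<times> {1..e + 1 - r})" by (simp add: card_cartesian_product)
    also have "\<dots> \<le> card (?K e)"
    proof (rule card_mono)
      show "finite (?K e)" by simp
      show "{1..m} \<times> {1..e + 1 - r} \<subseteq> ?K e" using l True by fastforce
    qed
    finally show ?thesis .
  next
    case False
    have "?K e = ?B" using l False by fastforce
    moreover have "card (?A e) \<le> card (verts G)" by (rule card_mono) auto
    ultimately show ?thesis using n by simp
  qed
qed

text \<open>
  If only the \<open>j\<close>-th path has the largest order \<open>q + 1\<close>, then the eccentricities along it start at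
  \<open>q\<close>, and along the other paths at \<open>q + 1\<close>. So the value \<open>q\<close> occurs only once, and counting
  \<open>m\<close> vertices of \<open>G\<close> with eccentricity \<open>q\<close> would be too weak; uniqueness of such a vertex repairs this.
\<close>

lemma total_eccentricity_ge_one_longest:
  fixes l :: "nat \<Rightarrow> nat"
  assumes m: "card noncut = m" and n: "card (verts G) = (\<Sum>i=1..m. l i)"
    and j: "j \<in> {1..m}" "l j = q + 1"
    and l: "\<And>i. i \<in> {1..m} \<Longrightarrow> i \<noteq> j \<Longrightarrow> l i = q"
  shows "(\<Sum>(i, k)\<in>(SIGMA i:{1..m}. {1..l i}). (if i = j then q else q + 1) + k - 1)
    \<le> total_eccentricity G"
  unfolding total_eccentricity_def
proof (rule sum_mono_if_card_atMost)
  let ?B = "SIGMA i:{1..m}. {1..l i}"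
  let ?A = "\<lambda>e. {v \<in> verts G. eccentricity G v \<le> e}"
  let ?K = "\<lambda>e. {x \<in> ?B. (case x of (i, k) \<Rightarrow> (if i = j then q else q + 1) + k - 1) \<le> e}"
  show "finite ?B" "finite (verts G)" by auto
  show "card ?B = card (verts G)" using n by simp
  have "(\<Sum>i=1..m. l i) = l j + (\<Sum>i\<in>{1..m}-{j}. l i)"
    using j(1) by (simp add: sum.remove)
  also have "(\<Sum>i\<in>{1..m}-{j}. l i) = (m - 1) * q"
    using l j(1) by simp
  finally have nq: "card (verts G) = 1 + m * q"
    using n j by (cases m) auto
  have m0: "0 < m" using j(1) by simp
  have ecc: "q \<le> eccentricity G v" if "v \<in> verts G" for v
    using card_verts_le_eccentricity[OF that] m nq m0 by simp
  fix e
  consider "e < q" | "q \<le> e" "e < 2 * q" | "2 * q \<le> e" by linarith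
  then show "card (?A e) \<le> card (?K e)"
  proof cases
    case 1
    then have "?A e = {}" using ecc by fastforce
    then show ?thesis by (metis card.empty le0)
  next
    case 2
    have "?A e \<subseteq> {v \<in> verts G. eccentricity G v = q}
        \<union> (\<Union>k\<in>{q+1..e}. {v \<in> verts G. eccentricity G v = k})"
    proof
      fix v assume "v \<in> ?A e"
      then show "v \<in> {v \<in> verts G. eccentricity G v = q}
          \<union> (\<Union>k\<in>{q+1..e}. {v \<in> verts G. eccentricity G v = k})"
        using ecc[of v] by (cases "eccentricity G v = q") auto
    qed
    then have "card (?A e) \<le> card ({v \<in> verts G. eccentricity G v = q}
        \<union> (\<Union>k\<in>{q+1..e}. {v \<in> verts G. eccentricity G v = k}))"
      by (intro card_mono) auto
    also have "\<dots> \<le> card {v \<in> verts G. eccentricity G v = q}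
        + card (\<Union>k\<in>{q+1..e}. {v \<in> verts G. eccentricity G v = k})"
      by (rule card_Un_le)
    also have "card {v \<in> verts G. eccentricity G v = q} \<le> 1"
      using unique_center_if_extremal nq m by (auto simp: card_le_Suc0_iff_eq)
    also have "card (\<Union>k\<in>{q+1..e}. {v \<in> verts G. eccentricity G v = k})
        \<le> (\<Sum>k\<in>{q+1..e}. card {v \<in> verts G. eccentricity G v = k})"
      by (rule card_UN_le) simp
    also have "\<dots> \<le> (\<Sum>k\<in>{q+1..e}. m)"
      using card_eccentricity_level m by (intro sum_mono) simp
    finally have "card (?A e) \<le> 1 + m * (e - q)" by (simp add: mult.commute)
    also have "\<dots> = card (insert (j, e + 1 - q) ({1..m} \<times> {1..e - q}))"
      using 2(1) by (subst card_insert_disjoint) (auto simp: card_cartesian_product)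
    also have "\<dots> \<le> card (?K e)"
    proof (rule card_mono)
      show "finite (?K e)" by simp
      have "1 \<le> e + 1 - q \<and> e + 1 - q \<le> q + 1 \<and> q + (e + 1 - q) - 1 \<le> e"
        using 2 by linarith
      then have "(j, e + 1 - q) \<in> ?K e" using j by simp
      moreover have "(i, k) \<in> ?K e" if "i \<in> {1..m}" "k \<in> {1..e - q}" for i k
        using that l[of i] j 2 by (cases "i = j") auto
      ultimately show "insert (j, e + 1 - q) ({1..m} \<times> {1..e - q}) \<subseteq> ?K e" by auto
    qed
    finally show ?thesis .
  next
    case 3
    have "(i, k) \<in> ?K e" if "(i, k) \<in> ?B" for i k
      using that l[of i] j 3 by (cases "i = j") auto
    then have "?K e = ?B" by auto
    moreover have "card (?A e) \<le> card (verts G)" by (rule card_mono) auto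
    ultimately show ?thesis using n by simp
  qed
qed

end

section \<open>Eccentricities in a clique with paths and the comparison\<close>

lemma clique_with_paths_awalk_along_path:
  assumes "\<And>i. i \<in> {1..m} \<Longrightarrow> 1 \<le> l i" and i: "i \<in> {1..m}"
    and ab: "1 \<le> a" "a \<le> b" "b \<le> l i"
  shows "\<exists>p. pre_digraph.awalk (with_proj (clique_with_paths m l)) (i, a) p (i, b) \<and> length p = b - a"
proof -
  interpret K: pair_graph "clique_with_paths m l"
    using assms(1) by (rule pair_graph_clique_with_paths)
  show ?thesis
    using ab(2,3)
  proof (induction b rule: dec_induct)
    case base
    have "(i, a) \<in> pverts (clique_with_paths m l)"
      using i ab by (simp add: clique_with_paths_def)
    then show ?case by (auto simp: K.awalk_Nil_iff intro: exI[of _ "[]"])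
  next
    case (step b)
    then obtain p where p: "K.awalk (i, a) p (i, b)" "length p = b - a" by auto
    have "((i, b), (i, b + 1)) \<in> parcs (clique_with_paths m l)"
      using i ab(1) step by (auto simp: clique_with_paths_def)
    then have "K.awalk (i, b) [((i, b), (i, b + 1))] (i, b + 1)"
      using K.arc_implies_awalk by fastforce
    with p(1) have "K.awalk (i, a) (p @ [((i, b), (i, b + 1))]) (i, Suc b)"
      using K.awalk_appendI by fastforce
    moreover have "length (p @ [((i, b), (i, b + 1))]) = Suc b - a"
      using p(2) step by simp
    ultimately show ?case by blast
  qed
qed

text \<open>
  From \<open>(i, k)\<close> it takes \<open>k - 1\<close> steps to the clique, one step to the end of another path, and at most
  \<open>M - 1\<close> steps along it. The assumption \<open>l i \<le> M + 1\<close> keeps the far end of the own path, at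
  distance \<open>l i - k\<close>, within the same bound.
\<close>

lemma eccentricity_clique_with_paths_le:
  assumes l: "\<And>i. i \<in> {1..m} \<Longrightarrow> 1 \<le> l i" and i: "i \<in> {1..m}" and k: "k \<in> {1..l i}"
    and M: "\<And>j. j \<in> {1..m} \<Longrightarrow> j \<noteq> i \<Longrightarrow> l j \<le> M" "l i \<le> M + 1"
  shows "eccentricity (with_proj (clique_with_paths m l)) (i, k) \<le> M + k - 1"
proof -
  let ?K = "clique_with_paths m l"
  interpret K: pair_graph ?K
    using l by (rule pair_graph_clique_with_paths)
  have up: "\<exists>p. K.awalk (i, a) p (i, b) \<and> length p = b - a"
    if "i \<in> {1..m}" "1 \<le> a" "a \<le> b" "b \<le> l i" for i a b
    using clique_with_paths_awalk_along_path[of m l] l that by blast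
  have down: "\<exists>p. K.awalk (i, b) p (i, a) \<and> length p = b - a"
    if "i \<in> {1..m}" "1 \<le> a" "a \<le> b" "b \<le> l i" for i a b
    using up[OF that] K.awalk_reverse_exists by metis
  show ?thesis
  proof (rule K.eccentricity_le)
    show "(i, k) \<in> pverts ?K" using i k by (simp add: clique_with_paths_def)
    fix u assume "u \<in> pverts ?K"
    then obtain j h where u: "u = (j, h)" and j: "j \<in> {1..m}" and h: "h \<in> {1..l j}"
      by (auto simp: clique_with_paths_def)
    have "\<exists>p. K.awalk (i, k) p u \<and> length p \<le> M + k - 1"
    proof (cases "i = j")
      case True
      show ?thesis
      proof (cases "k \<le> h")
        case True
        obtain p where "K.awalk (i, k) p u" "length p = h - k"
          using up[of i k h] i k h True u \<open>i = j\<close> by auto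
        moreover have "h - k \<le> M + k - 1" using h k M(2) \<open>i = j\<close> by auto
        ultimately show ?thesis by metis
      next
        case False
        obtain p where "K.awalk (i, k) p u" "length p = k - h"
          using down[of i h k] i k h False u \<open>i = j\<close> by auto
        moreover have "k - h \<le> M + k - 1" using h by auto
        ultimately show ?thesis by metis
      qed
    next
      case False
      obtain p1 where p1: "K.awalk (i, k) p1 (i, 1)" "length p1 = k - 1"
        using down[of i 1 k] i k by auto
      obtain p3 where p3: "K.awalk (j, 1) p3 (j, h)" "length p3 = h - 1"
        using up[of j 1 h] j h by auto
      have "((i, 1), (j, 1)) \<in> parcs ?K"
        using i j False by (auto simp: clique_with_paths_def)
      then have "K.awalk (i, 1) [((i, 1), (j, 1))] (j, 1)"
        using K.arc_implies_awalk by fastforce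
      with p1(1) p3(1) have "K.awalk (i, k) (p1 @ [((i, 1), (j, 1))] @ p3) u"
        unfolding u by (meson K.awalk_appendI)
      moreover have "length (p1 @ [((i, 1), (j, 1))] @ p3) \<le> M + k - 1"
        using p1(2) p3(2) k h M(1)[of j] j False by auto
      ultimately show ?thesis by blast
    qed
    then show "gdist ?K (i, k) u \<le> M + k - 1"
      using K.gdist_le_length le_trans by blast
  qed
qed

lemma total_eccentricity_clique_with_paths_le:
  assumes "\<And>i. i \<in> {1..m} \<Longrightarrow> 1 \<le> l i"
    and "\<And>i j. i \<in> {1..m} \<Longrightarrow> j \<in> {1..m} \<Longrightarrow> j \<noteq> i \<Longrightarrow> l j \<le> M i"
    and "\<And>i. i \<in> {1..m} \<Longrightarrow> l i \<le> M i + 1"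
  shows "total_eccentricity (with_proj (clique_with_paths m l))
    \<le> (\<Sum>(i, k)\<in>(SIGMA i:{1..m}. {1..l i}). M i + k - 1)"
proof -
  have "verts (with_proj (clique_with_paths m l)) = (SIGMA i:{1..m}. {1..l i})"
    by (simp add: clique_with_paths_def)
  moreover have "eccentricity (with_proj (clique_with_paths m l)) x \<le> (case x of (i, k) \<Rightarrow> M i + k - 1)"
    if x_in: "x \<in> (SIGMA i:{1..m}. {1..l i})" for x
  proof -
    obtain i k where x: "x = (i, k)" "i \<in> {1..m}" "k \<in> {1..l i}" using x_in by blast
    show ?thesis
      unfolding x(1) prod.case
      by (rule eccentricity_clique_with_paths_le) (use assms x(2,3) in blast)+
  qed
  ultimately show ?thesis
    unfolding total_eccentricity_def by (simp only: sum_mono)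
qed

theorem theorem4p5:
  fixes G :: "'a pair_pre_digraph" and n s :: nat and l' :: "nat \<Rightarrow> nat"
  assumes "2 \<le> n" and "s \<le> n - 2"
    and "G \<in> connected_graphs_with_cut_vertices n s"
    and "\<forall>i\<in>{1..n - s}. 1 \<le> l' i"
    and "(\<Sum>i=1..n - s. l' i) = n"
    and "\<forall>i\<in>{1..n - s}. \<forall>j\<in>{1..n - s}. \<bar>int (l' i) - int (l' j)\<bar> \<le> 1"
  shows "total_eccentricity (with_proj (clique_with_paths (n - s) l')) \<le> total_eccentricity (with_proj G)"
proof -
  define m where "m = n - s"
  have m: "2 \<le> m" using assms(1,2) unfolding m_def by linarith
  have G: "pair_graph G" "Digraph_Component.connected (with_proj G)" "card (pverts G) = n"
      "card {w. cut_vertex (with_proj G) w} = s"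
    using assms(3) unfolding connected_graphs_with_cut_vertices_def by auto
  interpret pair_graph G by (rule G(1))
  interpret nontrivial_connected_graph "with_proj G"
    by unfold_locales (use G assms(1) in auto)
  have "noncut = pverts G - {w. cut_vertex (with_proj G) w}"
    unfolding noncut_def by auto
  moreover have "{w. cut_vertex (with_proj G) w} \<subseteq> pverts G"
    unfolding cut_vertex_def by auto
  ultimately have card_noncut: "card noncut = m"
    using G(3,4) unfolding m_def by (simp add: card_Diff_subset finite_subset)
  have n: "card (verts (with_proj G)) = (\<Sum>i=1..m. l' i)" using G(3) assms(5) m_def by simp
  have pos: "1 \<le> l' i" if "i \<in> {1..m}" for i using assms(4) that m_def by blast
  have close: "l' i \<le> l' j + 1" if "i \<in> {1..m}" "j \<in> {1..m}" for i j
    using assms(6) that unfolding m_def by fastforce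
  define r where "r = Max (l' ` {1..m})"
  have "r \<in> l' ` {1..m}" unfolding r_def by (rule Max_in) (use m in auto)
  then obtain j where j: "j \<in> {1..m}" "l' j = r" by auto
  have le_r: "l' i \<le> r" if "i \<in> {1..m}" for i unfolding r_def using that by simp
  have ge_r: "r - 1 \<le> l' i" if "i \<in> {1..m}" for i using close[OF j(1) that] j(2) by linarith
  (* The largest order of a path other than the i-th is r for every i if r occurs twice;
     otherwise it is r - 1 for i = j. *)
  show ?thesis
  proof (cases "\<exists>i\<in>{1..m}. i \<noteq> j \<and> l' i = r")
    case True
    then obtain i where i: "i \<in> {1..m}" "i \<noteq> j" "l' i = r" by blast
    have "(\<Sum>h\<in>{1..m} - {i, j}. r - 1) \<le> (\<Sum>h\<in>{1..m} - {i, j}. l' h)"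
      using ge_r by (intro sum_mono) blast
    moreover have "(\<Sum>h=1..m. l' h) = (\<Sum>h\<in>{i, j}. l' h) + (\<Sum>h\<in>{1..m} - {i, j}. l' h)"
      using i(1) j(1) by (subst sum.subset_diff[of "{i, j}"]) auto
    moreover have "card ({1..m} - {i, j}) = m - 2"
      using i(1,2) j(1) by (simp add: card_Diff_subset)
    ultimately have "2 * r + (m - 2) * (r - 1) \<le> card (verts (with_proj G))"
      using i(2,3) j(2) n by simp
    moreover have "2 * r + (m - 2) * (r - 1) = m * (r - 1) + 2"
    proof -
      obtain r' m' where "r = Suc r'" "m = m' + 2"
        using pos[OF j(1)] j(2) m by (metis Suc_le_D One_nat_def le_add_diff_inverse2)
      then show ?thesis by simp
    qed
    ultimately have "m * (r - 1) + 2 \<le> card (verts (with_proj G))" by simp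
    then have "(\<Sum>(i, k)\<in>(SIGMA i:{1..m}. {1..l' i}). r + k - 1) \<le> total_eccentricity (with_proj G)"
      using total_eccentricity_ge_several_longest[OF card_noncut n] le_r ge_r by blast
    moreover have "total_eccentricity (with_proj (clique_with_paths m l'))
        \<le> (\<Sum>(i, k)\<in>(SIGMA i:{1..m}. {1..l' i}). r + k - 1)"
      by (rule total_eccentricity_clique_with_paths_le) (use pos le_r in \<open>auto intro: le_SucI\<close>)
    ultimately show ?thesis unfolding m_def by linarith
  next
    case False
    define q where "q = r - 1"
    have r: "r = q + 1" using pos[OF j(1)] j(2) unfolding q_def by simp
    have eq_q: "l' i = q" if "i \<in> {1..m}" "i \<noteq> j" for i
    proof -
      have "l' i \<noteq> r" using False that by blast
      then show ?thesis using le_r[OF that(1)] ge_r[OF that(1)] r by linarith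
    qed
    have "(\<Sum>(i, k)\<in>(SIGMA i:{1..m}. {1..l' i}). (if i = j then q else q + 1) + k - 1)
        \<le> total_eccentricity (with_proj G)"
      using total_eccentricity_ge_one_longest[OF card_noncut n j(1)] j(2) r eq_q by blast
    moreover have "total_eccentricity (with_proj (clique_with_paths m l'))
        \<le> (\<Sum>(i, k)\<in>(SIGMA i:{1..m}. {1..l' i}). (if i = j then q else q + 1) + k - 1)"
    proof (rule total_eccentricity_clique_with_paths_le)
      show "l' h \<le> (if i = j then q else q + 1)" if "i \<in> {1..m}" "h \<in> {1..m}" "h \<noteq> i" for i h
        using eq_q[of h] le_r[of h] r that by auto
      show "l' i \<le> (if i = j then q else q + 1) + 1" if "i \<in> {1..m}" for i
        using le_r[OF that] r by auto
    qed (rule pos)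
    ultimately show ?thesis unfolding m_def by linarith
  qed
qed

end
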